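(* Let $m\ge 3$ and let $\lambda$ be a trivial coloring on $\mathrm{P}^3(m)$ with $\lambda(c)=\lambda(f)=e_1$. Suppose that $\lambda$ is 2-independent. Then: (1) If $\lambda$ does not possess the property $(\star)$, then $m$ is even and $\lambda$ is sector-equivalent to the canonical form $\lambda_{C_1}$ with coloring sequence $\mathcal{C}_1=(\alpha,\beta,\dots,\alpha,\beta)$. (2) If $\lambda$ possesses the property $(\star)$, then $\lambda$ is sector-equivalent to one of the following two canonical forms: (a) $\lambda_{C_2}$, with $m$ even and coloring sequence $\mathcal{C}_2=(\alpha,\gamma,\alpha,\beta,\dots,\alpha,\beta)$; (b) $\lambda_{C_3}$, with $m$ odd and coloring sequence $\mathcal{C}_3=(\alpha,\gamma,\beta,\alpha,\beta,\dots,\alpha,\beta)$.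
   Context: $\mathrm{P}^3(m)=[0,1]\times(m\text{-gon})$, with ceiling $c$ and floor $f$ (the two $m$-gon faces; for $m=4$ a fixed pair of opposite faces) and side faces $s_1,\dots,s_m$ in cyclic order. A coloring $\lambda$ assigns to each facet a vector of $(\mathbb{Z}_2)^3$ such that facets with nonempty common intersection get linearly independent vectors. $\lambda$ is trivial if $\lambda(c)=\lambda(f)$; it is 2-independent if $\lambda(s_1),\dots,\lambda(s_m)$ span a 2-dimensional subspace of $(\mathbb{Z}_2)^3$. Fix a basis $\{e_1,\alpha,\beta\}$ of $(\mathbb{Z}_2)^3$ and put $\gamma=\alpha+\beta$, $\bar\alpha=\alpha+e_1$, $\bar\beta=\beta+e_1$, $\bar\gamma=\gamma+e_1$. A trivial coloring with $\lambda(c)=\lambda(f)=e_1$ is described by its coloring sequence $(\lambda(s_1),\dots,\lambda(s_m))$, viewed cyclically; the canonical forms $\lambda_{C_i}$ are colorings with ceiling and floor colored $e_1$ and side sequence $\mathcal{C}_i$ (dots denote repetition of $\alpha,\beta$). $\lambda$ has property $(\star)$ if each of the three letters $\alpha,\beta,\gamma$ (each with or without bar) appears in its coloring sequence. Sector-equivalence of trivial colorings is the equivalence relation generated by: (i) $\lambda\mapsto\sigma\circ\lambda$ with $\sigma\in\mathrm{GL}(3,\mathbb{Z}_2)$ (Davis–Januszkiewicz equivalence); (ii) cyclic rotation or reversal of the order of the side faces; (iii) the following operations for $k<l$, which change only the colors of the block $s_k,s_{k+1},\dots,s_l$: $\mathrm{O}_1$: if $\lambda(s_k)=\lambda(s_l)$,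 reverse the block. $\mathrm{O}_{21}$: if $\lambda(s_k)=\lambda(s_l)+\lambda(c)$, apply to each entry of the block the linear map that is the identity on $\mathrm{Span}\{\lambda(c),\lambda(s_k)\}$ and sends each $v$ outside it to $v+\lambda(c)$. $\mathrm{O}_{22}$: if $\lambda(s_k)=\lambda(s_l)+\lambda(c)$, choose $w$ with $\{\lambda(c),\lambda(s_k),w\}$ a basis, reverse the block, and apply to each entry the linear map $\lambda(c)\mapsto\lambda(c)$, $\lambda(s_k)\mapsto\lambda(s_l)$, $w\mapsto w$. $\mathrm{O}_{32}$: if $\lambda(s_k),\lambda(s_l),\lambda(c)$ are linearly independent, reverse the block and apply to each entry the linear map fixing $\lambda(c)$ and interchanging $\lambda(s_k)$ and $\lambda(s_l)$. *)

theory Defs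
  imports "HOL-Analysis.Analysis" "HOL-Library.Z2"
begin

type_synonym vec3 = "bit ^ 3"

abbreviation linear_map :: "(vec3 \<Rightarrow> vec3) \<Rightarrow> bool" where
  "linear_map \<equiv> Vector_Spaces.linear (*s) (*s)"

definition indep_family :: "('i \<Rightarrow> vec3) \<Rightarrow> 'i set \<Rightarrow> bool" where
  "indep_family v I \<longleftrightarrow> inj_on v I \<and> vec.independent (v ` I)"

definition indep_triple :: "vec3 \<Rightarrow> vec3 \<Rightarrow> vec3 \<Rightarrow> bool" where
  "indep_triple u v w \<longleftrightarrow> distinct [u, v, w] \<and> vec.independent {u, v, w}"

definition is_basis :: "vec3 \<Rightarrow> vec3 \<Rightarrow> vec3 \<Rightarrow> bool" where
  "is_basis u v w \<longleftrightarrow> indep_triple u v w \<and> vec.span {u, v, w} = UNIV"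

text \<open>
  The prism over an \<open>m\<close>-gon.  Side faces are numbered from \<open>0\<close>: the face \<open>s\<^sub>i\<close> of the
  usual numbering \<open>1, \<dots>, m\<close> is \<open>Side (i - 1)\<close>.
\<close>

datatype facet = Ceiling | Floor | Side nat

definition facets :: "nat \<Rightarrow> facet set" where
  "facets m = {Ceiling, Floor} \<union> Side ` {..<m}"

text \<open>
  The vertices of the prism are the pairs of an end of the interval and a vertex of the
  \<open>m\<close>-gon, whose edge number \<open>i\<close> joins the vertices \<open>i\<close> and \<open>i + 1\<close> modulo \<open>m\<close>.
  A nonempty intersection of facets is a face and so contains a vertex; hence facets have a
  common point if and only if they have a common vertex.
\<close>

fun facet_vertices :: "nat \<Rightarrow> facet \<Rightarrow> (bool \<times> nat) set" where
  "facet_vertices m Ceiling = {True} \<times> {..<m}"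
| "facet_vertices m Floor = {False} \<times> {..<m}"
| "facet_vertices m (Side i) = UNIV \<times> {i, Suc i mod m}"

text \<open>
  Colorings are extensional functions on the set of facets, so that equality of colorings is
  equality of the colors of all facets.
\<close>

type_synonym coloring = "facet \<Rightarrow> vec3"

definition is_coloring :: "nat \<Rightarrow> coloring \<Rightarrow> bool" where
  "is_coloring m lam \<longleftrightarrow> lam \<in> extensional (facets m) \<and>
     (\<forall>F \<subseteq> facets m. (\<Inter>x\<in>F. facet_vertices m x) \<noteq> {} \<longrightarrow> indep_family lam F)"

definition trivial_coloring :: "nat \<Rightarrow> coloring \<Rightarrow> bool" where
  "trivial_coloring m lam \<longleftrightarrow> is_coloring m lam \<and> lam Ceiling = lam Floor"

definition two_independent :: "nat \<Rightarrow> coloring \<Rightarrow> bool" where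
  "two_independent m lam \<longleftrightarrow> vec.dim (vec.span (lam ` Side ` {..<m})) = 2"

definition property_star :: "nat \<Rightarrow> vec3 \<Rightarrow> vec3 \<Rightarrow> vec3 \<Rightarrow> coloring \<Rightarrow> bool" where
  "property_star m e1 \<alpha> \<beta> lam \<longleftrightarrow>
     (\<forall>x \<in> {\<alpha>, \<beta>, \<alpha> + \<beta>}. \<exists>i<m. lam (Side i) \<in> {x, x + e1})"


definition permute_sides :: "nat \<Rightarrow> (nat \<Rightarrow> nat) \<Rightarrow> coloring \<Rightarrow> coloring" where
  "permute_sides m p lam =
     (\<lambda>x \<in> facets m. case x of Side i \<Rightarrow> lam (Side (p i)) | _ \<Rightarrow> lam x)"

definition map_block ::
  "nat \<Rightarrow> nat \<Rightarrow> (vec3 \<Rightarrow> vec3) \<Rightarrow> coloring \<Rightarrow> coloring" where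
  "map_block k l \<tau> lam = (\<lambda>x. case x of
       Side i \<Rightarrow> if k \<le> i \<and> i \<le> l then \<tau> (lam (Side i)) else lam x
     | _ \<Rightarrow> lam x)"

definition reverse_block :: "nat \<Rightarrow> nat \<Rightarrow> coloring \<Rightarrow> coloring" where
  "reverse_block k l lam = (\<lambda>x. case x of
       Side i \<Rightarrow> if k \<le> i \<and> i \<le> l then lam (Side (k + l - i)) else lam x
     | _ \<Rightarrow> lam x)"

inductive sector_move :: "nat \<Rightarrow> coloring \<Rightarrow> coloring \<Rightarrow> bool" for m :: nat where
  DJ: "\<lbrakk>linear_map \<sigma>; bij \<sigma>\<rbrakk> \<Longrightarrow> sector_move m lam (restrict (\<sigma> \<circ> lam) (facets m))"
| rotation: "sector_move m lam (permute_sides m (\<lambda>i. (i + r) mod m) lam)"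
| reversal: "sector_move m lam (permute_sides m (\<lambda>i. m - 1 - i) lam)"
| O1: "\<lbrakk>k < l; l < m; lam (Side k) = lam (Side l)\<rbrakk>
    \<Longrightarrow> sector_move m lam (reverse_block k l lam)"
| O21: "\<lbrakk>k < l; l < m; lam (Side k) = lam (Side l) + lam Ceiling;
      \<tau> = (\<lambda>v. if v \<in> vec.span {lam Ceiling, lam (Side k)} then v else v + lam Ceiling)\<rbrakk>
    \<Longrightarrow> sector_move m lam (map_block k l \<tau> lam)"
| O22: "\<lbrakk>k < l; l < m; lam (Side k) = lam (Side l) + lam Ceiling;
      is_basis (lam Ceiling) (lam (Side k)) w; linear_map \<tau>;
      \<tau> (lam Ceiling) = lam Ceiling; \<tau> (lam (Side k)) = lam (Side l); \<tau> w = w\<rbrakk>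
    \<Longrightarrow> sector_move m lam (map_block k l \<tau> (reverse_block k l lam))"
| O32: "\<lbrakk>k < l; l < m; indep_triple (lam (Side k)) (lam (Side l)) (lam Ceiling); linear_map \<tau>;
      \<tau> (lam Ceiling) = lam Ceiling; \<tau> (lam (Side k)) = lam (Side l);
      \<tau> (lam (Side l)) = lam (Side k)\<rbrakk>
    \<Longrightarrow> sector_move m lam (map_block k l \<tau> (reverse_block k l lam))"

definition sector_equivalent :: "nat \<Rightarrow> coloring \<Rightarrow> coloring \<Rightarrow> bool" where
  "sector_equivalent m lam mu \<longleftrightarrow> trivial_coloring m lam \<and> trivial_coloring m mu \<and>
     equivclp (\<lambda>x y. trivial_coloring m x \<and> trivial_coloring m y \<and> sector_move m x y) lam mu"


definition coloring_of_seq :: "vec3 \<Rightarrow> vec3 list \<Rightarrow> coloring" where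
  "coloring_of_seq e xs =
     (\<lambda>x \<in> facets (length xs). case x of Side i \<Rightarrow> xs ! i | _ \<Rightarrow> e)"

definition repeat_pair :: "nat \<Rightarrow> vec3 \<Rightarrow> vec3 \<Rightarrow> vec3 list" where
  "repeat_pair n \<alpha> \<beta> = concat (replicate n [\<alpha>, \<beta>])"

text \<open>
  The sequences below have length \<open>m\<close> for even \<open>m \<ge> 2\<close> in the first two cases and for
  odd \<open>m \<ge> 3\<close> in the third one.
\<close>

definition seq_C1 :: "nat \<Rightarrow> vec3 \<Rightarrow> vec3 \<Rightarrow> vec3 list" where
  "seq_C1 m \<alpha> \<beta> = repeat_pair (m div 2) \<alpha> \<beta>"

definition seq_C2 :: "nat \<Rightarrow> vec3 \<Rightarrow> vec3 \<Rightarrow> vec3 list" where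
  "seq_C2 m \<alpha> \<beta> = [\<alpha>, \<alpha> + \<beta>] @ repeat_pair ((m - 2) div 2) \<alpha> \<beta>"

definition seq_C3 :: "nat \<Rightarrow> vec3 \<Rightarrow> vec3 \<Rightarrow> vec3 list" where
  "seq_C3 m \<alpha> \<beta> = [\<alpha>, \<alpha> + \<beta>, \<beta>] @ repeat_pair ((m - 3) div 2) \<alpha> \<beta>"

end

theory Submission
  imports Defs
begin

text \<open>
  The side colors of a 2-independent coloring are the three nonzero vectors \<open>x, y, x + y\<close> of a
  plane avoiding \<open>e1\<close>. Ordering them cyclically, the coloring becomes a closed walk on a triangle,
  that is, a cyclic word in the letters \<open>1\<close> and \<open>-1\<close> with sum divisible by 3. On blocks of
  four faces, \<open>O\<^sub>3\<^sub>2\<close> moves a pair \<open>a a\<close> past any letter, and \<open>O\<^sub>1\<close> replaces \<open>a a a\<close> by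
  \<open>(-a) (-a) (-a)\<close>. Next to a pair, two distinct letters may therefore be exchanged, since
  \<open>a a a (-a)\<close> and \<open>a a (-a) a\<close> both become \<open>(-a) (-a) (-a) (-a)\<close>. Hence every word with a pair
  can be sorted, and then the number \<open>p\<close> of letters \<open>1\<close> reduced modulo 3; as \<open>p\<close> modulo 3 is
  determined by the length, all closed words of the same length with a pair are equivalent.
  A word has a pair as soon as all three colors occur; otherwise two colors alternate.
\<close>

section \<open>Linear algebra over the field with two elements\<close>

lemma vec3_add_self [simp]: "(v::vec3) + v = 0"
  by (simp add: vec_eq_iff)

lemma vec3_add_self_left [simp]: "(v::vec3) + (v + w) = w"
  by (simp flip: add.assoc)

lemma vec3_add_self_others [simp]:
  "(v::vec3) + w + w = v" "(v::vec3) + w + v = w" "(v::vec3) + (w + v) = w"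
  by (simp_all add: add_ac)

lemma vec3_minus: "(v::vec3) - w = v + w"
  by (simp add: vec_eq_iff)

lemma vec3_add_eq_0_iff: "(v::vec3) + w = 0 \<longleftrightarrow> v = w"
  using vec3_minus[of v w] by (metis right_minus_eq)

text \<open>The only scalars are 0 and 1, so membership in the span of a finite set unfolds to a
  finite disjunction.\<close>

lemma vec3_span_insert:
  "x \<in> vec.span (insert v S) \<longleftrightarrow> x \<in> vec.span S \<or> x + v \<in> vec.span S" for x v :: vec3
proof -
  have "(\<exists>k. x - k *s v \<in> vec.span S) \<longleftrightarrow> x - 0 *s v \<in> vec.span S \<or> x - 1 *s v \<in> vec.span S"
    by (metis bit.exhaust)
  then show ?thesis
    by (simp add: vec.span_breakdown_eq vec3_minus)
qed

lemma vec3_add_eq_iff: "(u::vec3) + v = w \<longleftrightarrow> u = w + v"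
  by auto

lemma vec3_span_pair: "vec.span {x, y} = {0, x, y, x + y}" for x y :: vec3
proof -
  have "v \<in> vec.span {x, y} \<longleftrightarrow> v \<in> {0, x, y, x + y}" for v
    using vec3_add_eq_iff[of v x y]
    by (auto simp: vec3_span_insert vec3_add_eq_0_iff add.commute)
  then show ?thesis by blast
qed

text \<open>A linear relation over the field with two elements is a vanishing sum over a nonempty
  subset; the seven subsets of a triple give the seven conditions.\<close>

lemma indep_triple_iff:
  "indep_triple u v w \<longleftrightarrow>
    u \<noteq> 0 \<and> v \<noteq> 0 \<and> w \<noteq> 0 \<and> u \<noteq> v \<and> u \<noteq> w \<and> v \<noteq> w \<and> u + v \<noteq> w"
proof (cases "distinct [u, v, w]")
  case True
  then have "vec.independent {u, v, w} \<longleftrightarrow>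
      u \<notin> vec.span {v, w} \<and> v \<notin> vec.span {w} \<and> w \<noteq> 0"
    by (auto simp: vec.independent_insert vec.independent_empty)
  then show ?thesis
    using True by (auto simp: indep_triple_def vec3_span_insert vec3_add_eq_0_iff)
qed (auto simp: indep_triple_def)

text \<open>Any two of the nonzero vectors \<open>x, y, x + y\<close> are a basis of the same
  plane.\<close>

lemma indep_triple_rearrange:
  assumes "indep_triple e x y"
  shows "indep_triple e y x" "indep_triple e x (x + y)" "indep_triple e (x + y) x"
    "indep_triple e y (x + y)" "indep_triple e (x + y) y"
proof -
  have "e = x + y \<longleftrightarrow> e + x = y" "e = x + y \<longleftrightarrow> e + y = x"
    by auto
  then show "indep_triple e y x" "indep_triple e x (x + y)" "indep_triple e (x + y) x"
    "indep_triple e y (x + y)" "indep_triple e (x + y) y"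
    using assms by (auto simp: indep_triple_iff vec3_add_eq_0_iff)
qed

lemma is_basis_iff: "is_basis u v w \<longleftrightarrow> indep_triple u v w"
proof
  assume indep: "indep_triple u v w"
  then have "card {u, v, w} = vec.dim (UNIV :: vec3 set)"
    unfolding vec_dim_card by (simp add: indep_triple_def)
  then have "UNIV \<subseteq> vec.span {u, v, w}"
    using vec.card_eq_dim[of "{u, v, w}" UNIV] indep by (simp add: indep_triple_def)
  with indep show "is_basis u v w"
    by (auto simp: is_basis_def)
qed (simp add: is_basis_def)

text \<open>The whole space is the union of the plane spanned by \<open>x, y\<close> and its
  translate by \<open>e\<close>.\<close>

lemma indep_triple_cases:
  assumes "indep_triple e x y"
  shows "v \<in> {0, x, y, x + y} \<or> v + e \<in> {0, x, y, x + y}"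
proof -
  have "v \<in> vec.span {e, x, y}"
    using assms unfolding is_basis_iff[symmetric] by (simp add: is_basis_def)
  then show ?thesis
    by (simp only: vec3_span_insert[of _ e] vec3_span_pair)
qed

lemma ex_linear_map:
  assumes "indep_triple u v w"
  obtains \<sigma> where "linear_map \<sigma>" "\<sigma> u = u'" "\<sigma> v = v'" "\<sigma> w = w'"
proof -
  from assms have d: "distinct [u, v, w]" and i: "vec.independent {u, v, w}"
    by (auto simp: indep_triple_def)
  obtain \<sigma> where "linear_map \<sigma>"
    "\<forall>x\<in>{u, v, w}. \<sigma> x = (if x = u then u' else if x = v then v' else w')"
    using vec.linear_independent_extend
      [OF i, of "\<lambda>x. if x = u then u' else if x = v then v' else w'"] by blast
  with d show ?thesis by (intro that[of \<sigma>]) auto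
qed

lemma bij_linear_map:
  assumes "linear_map \<sigma>" "is_basis u v w" "indep_triple (\<sigma> u) (\<sigma> v) (\<sigma> w)"
  shows "bij \<sigma>"
proof -
  have "inj_on \<sigma> (vec.span {u, v, w})"
    using assms(2,3) vec.linear_inj_on_span_iff_independent_image[OF assms(1), of "{u, v, w}"]
    by (auto simp: is_basis_def indep_triple_def)
  then have "inj \<sigma>"
    using assms(2) by (simp add: is_basis_def)
  then show ?thesis
    using assms(1) vec.linear_inj_imp_surj by (auto simp: bij_def)
qed

lemma ex_bij_linear_map:
  assumes "indep_triple u v w" "indep_triple u' v' w'"
  obtains \<sigma> where "linear_map \<sigma>" "bij \<sigma>" "\<sigma> u = u'" "\<sigma> v = v'" "\<sigma> w = w'"
  using assms ex_linear_map[of u v w u' v' w'] bij_linear_map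
  by (metis is_basis_iff)

section \<open>Words up to local moves\<close>

text \<open>
  A letter of a word is a step \<open>1\<close> (\<open>True\<close>) or \<open>-1\<close> (\<open>False\<close>) in the cyclic order of the
  three colors. Seen on four consecutive side faces, \<open>shift\<close> is an \<open>O\<^sub>3\<^sub>2\<close> operation and
  \<open>flip\<close> an \<open>O\<^sub>1\<close> operation.
\<close>

inductive word_move :: "bool list \<Rightarrow> bool list \<Rightarrow> bool" where
  rotate: "word_move (a # w) (w @ [a])"
| shift: "word_move ([a, a, b] @ w) ([b, a, a] @ w)"
| flip: "word_move ([a, a, a] @ w) ([\<not> a, \<not> a, \<not> a] @ w)"

abbreviation word_equiv :: "bool list \<Rightarrow> bool list \<Rightarrow> bool" (infix "\<simeq>" 50) where
  "word_equiv \<equiv> equivclp word_move"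

lemma word_equiv_rotate: "u @ v \<simeq> v @ u"
proof (induction u arbitrary: v)
  case (Cons a u)
  have "a # u @ v \<simeq> (u @ v) @ [a]"
    by (intro r_into_equivclp word_move.rotate)
  also have "\<dots> \<simeq> (v @ [a]) @ u"
    using Cons[of "v @ [a]"] by simp
  finally show ?case by simp
qed simp

text \<open>Words are cyclic: rotation carries any block to the front, where the moves act, and back
  again.\<close>

lemma word_equiv_context:
  assumes "\<And>w. s @ w \<simeq> t @ w"
  shows "u @ s @ v \<simeq> u @ t @ v"
proof -
  have "u @ s @ v \<simeq> s @ v @ u"
    using word_equiv_rotate[of u "s @ v"] by simp
  also have "\<dots> \<simeq> t @ v @ u"
    by (rule assms)
  also have "\<dots> \<simeq> u @ t @ v"
    using word_equiv_rotate[of "t @ v" u] by simp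
  finally show ?thesis .
qed

lemma word_equiv_shift: "u @ [a, a, b] @ v \<simeq> u @ [b, a, a] @ v"
  by (intro word_equiv_context r_into_equivclp word_move.shift)

lemma word_equiv_flip: "u @ [a, a, a] @ v \<simeq> u @ [\<not> a, \<not> a, \<not> a] @ v"
  by (intro word_equiv_context r_into_equivclp word_move.flip)

lemma word_equiv_pair_front: "u @ [a, a] @ v \<simeq> [a, a] @ u @ v"
proof (induction u arbitrary: v rule: rev_induct)
  case (snoc b u)
  have "(u @ [b]) @ [a, a] @ v \<simeq> u @ [a, a] @ b # v"
    using word_equiv_shift[of u a b v] by (simp add: equivclp_sym)
  also have "\<dots> \<simeq> [a, a] @ u @ b # v"
    by (rule snoc)
  finally show ?case by simp
qed simp

text \<open>If \<open>b\<close> and \<open>c\<close> differ, the two sides begin with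
  \<open>a, a, a, \<not> a\<close> and \<open>a, a, \<not> a, a\<close> in some order; a flip,
  respectively a shift and a flip, takes each to four letters \<open>\<not> a\<close>.\<close>

lemma word_equiv_swap_after_pair: "[a, a, b, c] @ w \<simeq> [a, a, c, b] @ w"
proof (cases "b = c")
  case False
  have 1: "[a, a, a, \<not> a] @ w \<simeq> [\<not> a, \<not> a, \<not> a, \<not> a] @ w"
    using word_equiv_flip[of "[]" a "(\<not> a) # w"] by simp
  have "[a, a, \<not> a, a] @ w \<simeq> [\<not> a, a, a, a] @ w"
    using word_equiv_shift[of "[]" a "\<not> a" "a # w"] by simp
  also have "\<dots> \<simeq> [\<not> a, \<not> a, \<not> a, \<not> a] @ w"
    using word_equiv_flip[of "[\<not> a]" a w] by simp
  finally have 2: "[a, a, \<not> a, a] @ w \<simeq> [\<not> a, \<not> a, \<not> a, \<not> a] @ w" .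
  have "[a, a, a, \<not> a] @ w \<simeq> [a, a, \<not> a, a] @ w"
    using 1 2 by (meson equivclp_sym equivclp_trans)
  moreover have "b = a \<and> c = (\<not> a) \<or> b = (\<not> a) \<and> c = a"
    using False by auto
  ultimately show ?thesis by (auto simp: equivclp_sym)
qed simp

text \<open>The leading pair travels to the two letters, allows their exchange there, and travels
  back.\<close>

lemma word_equiv_swap: "[a, a] @ u @ [b, c] @ v \<simeq> [a, a] @ u @ [c, b] @ v"
proof -
  have "[a, a] @ u @ [b, c] @ v \<simeq> u @ [a, a, b, c] @ v"
    using word_equiv_pair_front[of u a "[b, c] @ v"] by (simp add: equivclp_sym)
  also have "\<dots> \<simeq> u @ [a, a, c, b] @ v"
    by (intro word_equiv_context word_equiv_swap_after_pair)
  also have "\<dots> \<simeq> [a, a] @ u @ [c, b] @ v"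
    using word_equiv_pair_front[of u a "[c, b] @ v"] by simp
  finally show ?thesis .
qed

lemma word_equiv_bring: "[a, a] @ t @ u @ c # v \<simeq> [a, a] @ t @ c # u @ v"
proof (induction u arbitrary: v rule: rev_induct)
  case (snoc b u)
  have "[a, a] @ t @ (u @ [b]) @ c # v \<simeq> [a, a] @ t @ u @ c # b # v"
    using word_equiv_swap[of a "t @ u" b c v] by simp
  also have "\<dots> \<simeq> [a, a] @ t @ c # u @ b # v"
    by (rule snoc)
  finally show ?case by simp
qed simp

text \<open>Adjacent exchanges generate all permutations. The prefix \<open>t\<close> collects the
  letters already in place, so the induction leaves it arbitrary.\<close>

lemma word_equiv_permute:
  assumes "mset v = mset v'"
  shows "[a, a] @ t @ v \<simeq> [a, a] @ t @ v'"
  using assms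
proof (induction v arbitrary: t v')
  case (Cons c v)
  then have "c \<in> set v'" by (metis list.set_intros(1) mset_eq_setD)
  then obtain s s' where v': "v' = s @ c # s'" by (meson split_list)
  have "[a, a] @ t @ c # v \<simeq> [a, a] @ t @ c # s @ s'"
    using Cons.IH[of "s @ s'" "t @ [c]"] Cons.prems v' by simp
  also have "\<dots> \<simeq> [a, a] @ t @ s @ c # s'"
    by (intro equivclp_sym[OF word_equiv_bring])
  finally show ?case using v' by simp
qed simp

lemma mset_bool_list:
  "mset v = mset (replicate (count_list v True) True @ replicate (count_list v False) False)"
  by (induction v) auto

lemma word_equiv_sorted:
  assumes "w = u @ [a, a] @ v"
  shows "w \<simeq> replicate (count_list w True) True @ replicate (count_list w False) False"
proof -
  let ?T = "\<lambda>n. replicate n True" and ?F = "\<lambda>n. replicate n False"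
  define z where "z = u @ v"
  have "w \<simeq> [a, a] @ z"
    unfolding assms z_def by (rule word_equiv_pair_front)
  also have "\<dots> \<simeq> [a, a] @ ?T (count_list z True) @ ?F (count_list z False)"
    using word_equiv_permute[OF mset_bool_list, of a "[]" z] by simp
  finally have 1: "w \<simeq> [a, a] @ ?T (count_list z True) @ ?F (count_list z False)" .
  show ?thesis
  proof (cases a)
    case True
    then show ?thesis using 1 by (simp add: assms z_def)
  next
    case False
    \<comment> \<open>A pair of letters \<open>False\<close> belongs behind the sorted rest, and
      rotation takes it there.\<close>
    have "[a, a] @ ?T (count_list z True) @ ?F (count_list z False)
      \<simeq> ?T (count_list z True) @ ?F (count_list z False) @ [a, a]"
      using word_equiv_rotate[of "[a, a]"
          "?T (count_list z True) @ ?F (count_list z False)"] by simp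
    also have "\<dots> = ?T (count_list w True) @ ?F (count_list w False)"
      using False by (simp add: assms z_def replicate_app_Cons_same replicate_append_same)
    finally show ?thesis using 1 by (metis equivclp_trans)
  qed
qed

text \<open>Three leading letters \<open>True\<close> are flipped to \<open>False\<close> and
  rotated to the end, until fewer than three are left.\<close>

lemma word_equiv_sorted_mod3:
  "replicate p True @ replicate q False
    \<simeq> replicate (p mod 3) True @ replicate (p + q - p mod 3) False"
proof (induction p arbitrary: q rule: less_induct)
  case (less p)
  show ?case
  proof (cases "p < 3")
    case False
    define r where "r = p - 3"
    have p: "p = 3 + r" using False by (simp add: r_def)
    have "replicate p True @ replicate q False
      = [] @ [True, True, True] @ replicate r True @ replicate q False"
      by (simp add: p numeral_3_eq_3)
    also have "\<dots> \<simeq> [] @ [False, False, False] @ replicate r True @ replicate q False"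
      using word_equiv_flip[of "[]" True] by simp
    also have "\<dots> \<simeq> (replicate r True @ replicate q False) @ [False, False, False]"
      using word_equiv_rotate[of "[False, False, False]"
          "replicate r True @ replicate q False"] by simp
    also have "\<dots> = replicate r True @ replicate (q + 3) False"
      by (simp add: numeral_3_eq_3 replicate_app_Cons_same replicate_append_same)
    also have "\<dots> \<simeq> replicate (r mod 3) True @ replicate (r + (q + 3) - r mod 3) False"
      by (rule less) (simp add: p)
    finally show ?thesis by (simp add: p add_ac)
  qed simp
qed

text \<open>A word is closed if it has as many letters \<open>True\<close> as \<open>False\<close> modulo 3, since \<open>2 = -1\<close>.\<close>

definition closed_word :: "bool list \<Rightarrow> bool" where
  "closed_word w \<longleftrightarrow> 3 dvd count_list w True + 2 * count_list w False"

lemma length_eq_counts: "length w = count_list w True + count_list w False"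
  by (induction w) auto

lemma closed_words_equiv:
  assumes "closed_word w" "closed_word w'" "length w = length w'"
    and "w = u @ [a, a] @ v" "w' = u' @ [b, b] @ v'"
  shows "w \<simeq> w'"
proof -
  have norm: "w \<simeq> replicate (2 * length w mod 3) True
      @ replicate (length w - 2 * length w mod 3) False"
    if "closed_word w" "w = u @ [a, a] @ v" for w u a v
  proof -
    \<comment> \<open>With p letters \<open>True\<close> and q letters \<open>False\<close>,
      closedness gives p = q modulo 3. The length is then 2p modulo 3, and doubling it returns p
      because 4 = 1.\<close>
    have "count_list w True mod 3 = 2 * length w mod 3"
      using that(1) unfolding closed_word_def length_eq_counts by presburger
    then show ?thesis
      using word_equiv_sorted[OF that(2)]
        word_equiv_sorted_mod3[of "count_list w True" "count_list w False"]
      unfolding length_eq_counts[of w] by (metis equivclp_trans)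
  qed
  show ?thesis
    using norm[OF assms(1,4)] norm[OF assms(2,5)] assms(3)
    by (metis equivclp_sym equivclp_trans)
qed

section \<open>Colorings and sector-equivalence\<close>

lemma Suc_mod_inj:
  assumes "i < m" "j < m" "Suc i mod m = Suc j mod m"
  shows "i = j"
  using assms by (auto simp: mod_Suc split: if_splits)

text \<open>A vertex of the prism lies on one end face and two consecutive side faces, so facets
  with a common vertex form a subset of such a triple. Equal end colors leave one condition for each
  pair of consecutive sides.\<close>

lemma trivial_coloring_iff:
  assumes "m \<ge> 2"
  shows "trivial_coloring m lam \<longleftrightarrow> lam \<in> extensional (facets m) \<and> lam Ceiling = lam Floor \<and>
    (\<forall>i<m. indep_triple (lam Ceiling) (lam (Side i)) (lam (Side (Suc i mod m))))"
    (is "?L \<longleftrightarrow> ?R")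
proof
  assume L: ?L
  have "indep_triple (lam Ceiling) (lam (Side i)) (lam (Side (Suc i mod m)))" if "i < m" for i
  proof -
    let ?F = "{Ceiling, Side i, Side (Suc i mod m)}"
    have "(True, Suc i mod m) \<in> (\<Inter>x\<in>?F. facet_vertices m x)" "?F \<subseteq> facets m"
      using that by (auto simp: facets_def)
    then have "indep_family lam ?F"
      using L unfolding trivial_coloring_def is_coloring_def by blast
    moreover have "i \<noteq> Suc i mod m"
      using that assms by (auto simp: mod_Suc)
    ultimately show ?thesis
      by (auto simp: indep_family_def indep_triple_def)
  qed
  with L show ?R
    by (auto simp: trivial_coloring_def is_coloring_def)
next
  assume R: ?R
  have "indep_family lam F"
    if F: "F \<subseteq> facets m" and ne: "(\<Inter>x\<in>F. facet_vertices m x) \<noteq> {}" for F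
  proof (cases "F = {}")
    case False
    obtain b j where bj: "\<And>x. x \<in> F \<Longrightarrow> (b, j) \<in> facet_vertices m x"
      using ne by auto
    have "j < m"
    proof -
      obtain x where "x \<in> F" using False by auto
      then show ?thesis
        using bj[of x] F assms by (cases x) (auto simp: facets_def)
    qed
    \<comment> \<open>The side faces through the polygon vertex \<open>j\<close> are
      \<open>Side j\<close> and its cyclic predecessor; adding \<open>m\<close> first prevents
      truncation at \<open>j = 0\<close>.\<close>
    define i where "i = (j + m - 1) mod m"
    have i: "i < m" "Suc i mod m = j"
      using \<open>j < m\<close> by (auto simp: i_def mod_Suc_eq)
    define c where "c = (if b then Ceiling else Floor)"
    have sub: "F \<subseteq> {c, Side i, Side j}"
    proof
      fix x assume "x \<in> F"
      then show "x \<in> {c, Side i, Side j}"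
      proof (cases x)
        case (Side k)
        then have "k < m" "j = k \<or> j = Suc k mod m"
          using bj[of x] F \<open>x \<in> F\<close> by (auto simp: facets_def)
        then have "k = j \<or> k = i"
          using i Suc_mod_inj[of k m i] by auto
        then show ?thesis using Side by blast
      qed (use bj[of x] \<open>x \<in> F\<close> in \<open>auto simp: c_def\<close>)
    qed
    have "indep_triple (lam c) (lam (Side i)) (lam (Side j))"
      using R i by (auto simp: c_def)
    then have "inj_on lam {c, Side i, Side j}" "vec.independent (lam ` {c, Side i, Side j})"
      by (auto simp: indep_triple_def)
    with sub show ?thesis
      unfolding indep_family_def by (meson image_mono inj_on_subset vec.independent_mono)
  qed (simp add: indep_family_def vec.independent_empty)
  with R show ?L
    by (auto simp: trivial_coloring_def is_coloring_def)
qed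

lemma coloring_of_seq_simps [simp]:
  "coloring_of_seq e xs Ceiling = e"
  "coloring_of_seq e xs Floor = e"
  "i < length xs \<Longrightarrow> coloring_of_seq e xs (Side i) = xs ! i"
  "coloring_of_seq e xs \<in> extensional (facets (length xs))"
  by (auto simp: coloring_of_seq_def facets_def)

lemma eq_coloring_of_seq:
  assumes "lam \<in> extensional (facets (length xs))" "lam Ceiling = e" "lam Floor = e"
    and "\<And>i. i < length xs \<Longrightarrow> lam (Side i) = xs ! i"
  shows "lam = coloring_of_seq e xs"
proof (rule extensionalityI[OF assms(1)])
  fix x assume "x \<in> facets (length xs)"
  then show "lam x = coloring_of_seq e xs x"
    using assms(2-4) by (auto simp: facets_def)
qed simp

lemma trivial_coloring_of_seq:
  assumes "length xs \<ge> 2"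
    and "\<And>i. i < length xs \<Longrightarrow> indep_triple e (xs ! i) (xs ! (Suc i mod length xs))"
  shows "trivial_coloring (length xs) (coloring_of_seq e xs)"
proof -
  have "Suc i mod length xs < length xs" for i
    using assms(1) by (intro mod_less_divisor) linarith
  with assms show ?thesis by (auto simp: trivial_coloring_iff)
qed

section \<open>Basic laws of sector-equivalence\<close>

lemma sector_equivalent_refl: "trivial_coloring m lam \<Longrightarrow> sector_equivalent m lam lam"
  by (simp add: sector_equivalent_def)

lemma sector_equivalent_sym: "sector_equivalent m lam mu \<Longrightarrow> sector_equivalent m mu lam"
  by (auto simp: sector_equivalent_def intro: equivclp_sym)

lemma sector_equivalent_trans [trans]:
  "sector_equivalent m lam mu \<Longrightarrow> sector_equivalent m mu nu \<Longrightarrow> sector_equivalent m lam nu"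
  unfolding sector_equivalent_def by (blast intro: equivclp_trans)

lemma sector_equivalent_move:
  "trivial_coloring m lam \<Longrightarrow> trivial_coloring m mu \<Longrightarrow> sector_move m lam mu
    \<Longrightarrow> sector_equivalent m lam mu"
  unfolding sector_equivalent_def by (blast intro: r_into_equivclp)

lemma sector_equivalent_linear_map:
  assumes "linear_map \<sigma>" "bij \<sigma>" "\<sigma> e = e"
    and "trivial_coloring (length xs) (coloring_of_seq e xs)"
    and "trivial_coloring (length xs) (coloring_of_seq e (map \<sigma> xs))"
  shows "sector_equivalent (length xs) (coloring_of_seq e xs) (coloring_of_seq e (map \<sigma> xs))"
proof -
  have "restrict (\<sigma> \<circ> coloring_of_seq e xs) (facets (length xs)) = coloring_of_seq e (map \<sigma> xs)"
    using assms(3) by (intro eq_coloring_of_seq) (auto simp: facets_def)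
  then show ?thesis
    using sector_move.DJ[OF assms(1,2)] assms(4,5) by (metis sector_equivalent_move)
qed

section \<open>Colorings given by words\<close>

text \<open>
  A state \<open>(x, y)\<close> holds the current color \<open>x\<close> and the cyclic order \<open>x, y, x + y\<close> of the three
  nonzero vectors of a plane.
\<close>

fun step :: "bool \<Rightarrow> vec3 \<times> vec3 \<Rightarrow> vec3 \<times> vec3" where
  "step True (x, y) = (y, x + y)"
| "step False (x, y) = (x + y, x)"

text \<open>Each face gets the color held before its letter is read. The state after the last letter
  gives no entry; for a closed word it is the initial state again.\<close>

definition word_seq :: "vec3 \<times> vec3 \<Rightarrow> bool list \<Rightarrow> vec3 list" where
  "word_seq s w = map (\<lambda>i. fst (fold step (take i w) s)) [0..<length w]"

lemma length_word_seq [simp]: "length (word_seq s w) = length w"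
  by (simp add: word_seq_def)

lemma nth_word_seq [simp]:
  "i < length w \<Longrightarrow> word_seq s w ! i = fst (fold step (take i w) s)"
  by (simp add: word_seq_def)

abbreviation word_coloring :: "vec3 \<Rightarrow> vec3 \<times> vec3 \<Rightarrow> bool list \<Rightarrow> coloring" where
  "word_coloring e s w \<equiv> coloring_of_seq e (word_seq s w)"

lemma word_seq_Cons: "word_seq s (a # w) = fst s # word_seq (step a s) w"
  by (rule nth_equalityI) (auto simp: nth_Cons split: nat.split)

lemma word_seq_not_Nil:
  assumes "v \<noteq> []"
  obtains xs where "word_seq s v = fst s # xs"
  using assms by (cases v) (auto simp: word_seq_Cons)

lemma step_not_step [simp]: "step (\<not> a) (step a s) = s"
  by (cases s; cases a) (auto simp: add_ac)

text \<open>\<open>step True\<close> is a rotation of order 3 of the triangle of colors, and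
  \<open>step False\<close>, its inverse, is its square.\<close>

lemma fold_step_funpow:
  "fold step w s = (step True ^^ (count_list w True + 2 * count_list w False)) s"
proof (induction w arbitrary: s)
  case (Cons b w)
  have "step False s = (step True ^^ 2) s"
    by (cases s) (simp add: numeral_2_eq_2 add_ac)
  then have "step b s = (step True ^^ (if b then 1 else 2)) s"
    by simp
  then have "fold step (b # w) s
      = (step True ^^ (count_list w True + 2 * count_list w False + (if b then 1 else 2))) s"
    by (simp only: fold.simps comp_apply Cons funpow_add)
  also have "count_list w True + 2 * count_list w False + (if b then 1 else 2)
      = count_list (b # w) True + 2 * count_list (b # w) False"
    by simp
  finally show ?case .
qed simp

lemma funpow_step_mod3: "(step True ^^ n) s = (step True ^^ (n mod 3)) s"
proof -
  have "(step True ^^ 3) t = t" for t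
    by (cases t) (simp add: numeral_3_eq_3 add_ac)
  then have "(step True ^^ 3) = id" by auto
  then have "(step True ^^ (3 * k)) = id" for k
    by (metis funpow_mult id_funpow)
  then show ?thesis
    by (metis comp_id funpow_add mod_mult_div_eq)
qed

lemma fold_step_cases:
  "fold step w (x, y) \<in> {(x, y), (y, x + y), (x + y, x)}"
proof -
  define n where "n = (count_list w True + 2 * count_list w False) mod 3"
  have "fold step w (x, y) = (step True ^^ n) (x, y)"
    unfolding n_def by (subst fold_step_funpow, rule funpow_step_mod3)
  moreover have "n = 0 \<or> n = 1 \<or> n = 2"
    unfolding n_def by linarith
  ultimately show ?thesis
    by (auto simp: numeral_2_eq_2 add_ac)
qed

lemma fold_step_closed: "closed_word w \<Longrightarrow> fold step w s = s"
  unfolding closed_word_def fold_step_funpow funpow_step_mod3[of "_ + _"] by simp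

text \<open>The inequations \<open>x \<noteq> y\<close> and \<open>y \<noteq> 0\<close> exclude the
  exponents 1 and 2 of the rotation, respectively.\<close>

lemma closed_wordI:
  assumes "fold step w (x, y) = (x, y)" "x \<noteq> y" "y \<noteq> 0"
  shows "closed_word w"
proof -
  define n where "n = (count_list w True + 2 * count_list w False) mod 3"
  have "(step True ^^ n) (x, y) = (x, y)"
    using assms(1) unfolding n_def by (metis fold_step_funpow funpow_step_mod3)
  moreover have "n = 0 \<or> n = 1 \<or> n = 2"
    unfolding n_def by linarith
  ultimately have "n = 0"
    using assms(2,3) by (auto simp: numeral_2_eq_2 add_ac)
  then show ?thesis
    by (simp add: n_def closed_word_def dvd_eq_mod_eq_0)
qed

lemma indep_step:
  assumes "indep_triple e (fst s) (snd s)"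
  shows "indep_triple e (fst (step a s)) (snd (step a s))"
    and "indep_triple e (fst s) (fst (step a s))"
  using assms indep_triple_rearrange[OF assms] by (cases s; cases a; simp)+

lemma indep_fold_step:
  "indep_triple e (fst s) (snd s)
    \<Longrightarrow> indep_triple e (fst (fold step w s)) (snd (fold step w s))"
proof (induction w arbitrary: s)
  case (Cons a w)
  show ?case
    using Cons.IH[OF indep_step(1)[OF Cons.prems]] by simp
qed simp

lemma trivial_word_coloring:
  assumes "closed_word w" "length w \<ge> 2" "indep_triple e (fst s) (snd s)"
  shows "trivial_coloring (length w) (word_coloring e s w)"
proof -
  have "indep_triple e (word_seq s w ! i) (word_seq s w ! (Suc i mod length w))"
    if "i < length w" for i
  proof -
    \<comment> \<open>Only the last face needs closedness: its successor is face 0, and the full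
      walk has returned to the state \<open>s\<close>.\<close>
    have "fst (fold step (take (Suc i mod length w) w) s) = fst (fold step (take (Suc i) w) s)"
      using that fold_step_closed[OF assms(1), of s] by (cases "Suc i = length w") auto
    also have "\<dots> = fst (step (w ! i) (fold step (take i w) s))"
      using that by (simp add: take_Suc_conv_app_nth)
    finally have "fst (fold step (take (Suc i mod length w) w) s)
      = fst (step (w ! i) (fold step (take i w) s))" .
    moreover have "Suc i mod length w < length w"
      using that by (intro mod_less_divisor) linarith
    ultimately show ?thesis
      using that indep_step(2)[OF indep_fold_step[OF assms(3)]] by simp
  qed
  then show ?thesis
    using trivial_coloring_of_seq[of "word_seq s w"] assms(2) by simp
qed

text \<open>Steps use only addition, so linear maps commute with them. The map that fixes
  \<open>e\<close> and sends \<open>x, y\<close> to the components of \<open>s\<close> is a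
  Davis-Januszkiewicz equivalence.\<close>

lemma sector_equivalent_change_state:
  assumes "indep_triple e x y" "indep_triple e (fst s) (snd s)" "closed_word w" "length w \<ge> 2"
  shows "sector_equivalent (length w) (word_coloring e (x, y) w) (word_coloring e s w)"
proof -
  obtain \<sigma> where \<sigma>: "linear_map \<sigma>" "bij \<sigma>" "\<sigma> e = e" "\<sigma> x = fst s" "\<sigma> y = snd s"
    using ex_bij_linear_map[OF assms(1,2)] .
  have step: "step a (map_prod \<sigma> \<sigma> t) = map_prod \<sigma> \<sigma> (step a t)" for a t
    using vec.linear_add[OF \<sigma>(1)] by (cases t; cases a) auto
  have "s = map_prod \<sigma> \<sigma> (x, y)"
    using \<sigma>(4,5) by (simp add: prod_eq_iff)
  moreover have "fold step v (map_prod \<sigma> \<sigma> t) = map_prod \<sigma> \<sigma> (fold step v t)" for v t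
    by (induction v arbitrary: t) (auto simp: step)
  ultimately have "fold step v s = map_prod \<sigma> \<sigma> (fold step v (x, y))" for v
    by metis
  then have "word_seq s w = map \<sigma> (word_seq (x, y) w)"
    by (simp add: word_seq_def)
  then show ?thesis
    using sector_equivalent_linear_map[OF \<sigma>(1-3), of "word_seq (x, y) w"] assms
      trivial_word_coloring[of w e s] trivial_word_coloring[of w e "(x, y)"] by simp
qed

section \<open>Word moves realized by operations on the side faces\<close>

lemma extensional_block_maps:
  assumes "lam \<in> extensional (facets m)" "l < m"
  shows "reverse_block k l lam \<in> extensional (facets m)"
    and "map_block k l \<tau> lam \<in> extensional (facets m)"
proof -
  have "reverse_block k l lam x = lam x" "map_block k l \<tau> lam x = lam x" if "x \<notin> facets m" for x
    using that assms(2) by (cases x; force simp: reverse_block_def map_block_def facets_def)+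
  then show "reverse_block k l lam \<in> extensional (facets m)"
    "map_block k l \<tau> lam \<in> extensional (facets m)"
    using assms(1) by (simp_all add: extensional_def)
qed

lemma block_maps_ends [simp]:
  "reverse_block k l lam Ceiling = lam Ceiling" "reverse_block k l lam Floor = lam Floor"
  "map_block k l \<tau> lam Ceiling = lam Ceiling" "map_block k l \<tau> lam Floor = lam Floor"
  by (simp_all add: reverse_block_def map_block_def)

text \<open>Starting at the second face advances the initial state by the first letter; closedness
  makes the color that wraps around fit at the end.\<close>

lemma permute_sides_word_coloring:
  assumes "closed_word (a # w)"
  shows "permute_sides (Suc (length w)) (\<lambda>i. (i + 1) mod Suc (length w)) (word_coloring e s (a # w))
    = word_coloring e (step a s) (w @ [a])"
proof -
  have "word_coloring e s (a # w) (Side ((i + 1) mod Suc (length w)))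
      = fst (fold step (take i w) (step a s))" if "i < Suc (length w)" for i
  proof (cases "i = length w")
    case True
    then show ?thesis
      using fold_step_closed[OF assms, of s] by simp
  next
    case False
    then show ?thesis using that by simp
  qed
  then show ?thesis
    by (intro eq_coloring_of_seq) (auto simp: permute_sides_def facets_def)
qed

text \<open>Rotations and shifts permute the letters, and a flip changes the weighted count by
  3.\<close>

lemma word_move_closed: "word_move w w' \<Longrightarrow> closed_word w \<longleftrightarrow> closed_word w'"
proof (induction rule: word_move.induct)
  case (flip a w)
  show ?case by (cases a) (auto simp: closed_word_def, presburger+)
qed (auto simp: closed_word_def add_ac)

lemma word_move_length: "word_move w w' \<Longrightarrow> length w = length w'"
  by (induction rule: word_move.induct) auto

text \<open>The first four faces have colors \<open>x, z, x + z, z\<close>. Reversing them and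
  interchanging \<open>x\<close> and \<open>z\<close> gives \<open>x, x + z, x, z\<close>, the
  colors of the shifted word. A nonempty \<open>v\<close> ensures that the fourth face
  exists.\<close>

lemma sector_move_shift:
  assumes "indep_triple e x y" "v \<noteq> []"
  shows "sector_move (length v + 3) (word_coloring e (x, y) ([a, a, \<not> a] @ v))
    (word_coloring e (x, y) ([\<not> a, a, a] @ v))"
proof -
  let ?lam = "word_coloring e (x, y) ([a, a, \<not> a] @ v)"
  define z where "z = fst (step a (x, y))"
  have i: "indep_triple x z e"
    using indep_step(2)[of e "(x, y)" a] assms(1)
    by (auto simp: z_def indep_triple_iff add_ac)
  obtain \<tau> where \<tau>: "linear_map \<tau>" "\<tau> x = z" "\<tau> z = x" "\<tau> e = e"
    using ex_linear_map[OF i] .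
  have \<tau>': "\<tau> (x + z) = x + z"
    using vec.linear_add[OF \<tau>(1)] \<tau>(2,3) by (simp add: add.commute)
  have s: "?lam (Side 0) = x" "?lam (Side 1) = z" "?lam (Side 2) = x + z" "?lam (Side 3) = z"
    using assms by (cases a, auto simp: word_seq_Cons z_def nth_Cons' elim!: word_seq_not_Nil[of v])+
  have t: "word_seq (x, y) ([\<not> a, a, a] @ v) ! 0 = x" "word_seq (x, y) ([\<not> a, a, a] @ v) ! 1 = x + z" "word_seq (x, y) ([\<not> a, a, a] @ v) ! 2 = x" "word_seq (x, y) ([\<not> a, a, a] @ v) ! 3 = z"
    using assms by (cases a, auto simp: word_seq_Cons z_def nth_Cons' elim!: word_seq_not_Nil[of v])+
  have ext: "map_block 0 3 \<tau> (reverse_block 0 3 ?lam)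
      \<in> extensional (facets (length (word_seq (x, y) ([\<not> a, a, a] @ v))))"
    using assms(2) coloring_of_seq_simps(4)[of e "word_seq (x, y) ([a, a, \<not> a] @ v)"]
    by (intro extensional_block_maps) auto
  have "word_coloring e (x, y) ([\<not> a, a, a] @ v) = map_block 0 3 \<tau> (reverse_block 0 3 ?lam)"
  proof (rule sym[OF eq_coloring_of_seq])
    fix i assume i: "i < length (word_seq (x, y) ([\<not> a, a, a] @ v))"
    consider "i = 0" | "i = 1" | "i = 2" | "i = 3" | j where "i = Suc (Suc (Suc (Suc j)))"
      by (metis One_nat_def numeral_2_eq_2 numeral_3_eq_3 old.nat.exhaust)
    then show "map_block 0 3 \<tau> (reverse_block 0 3 ?lam) (Side i)
        = word_seq (x, y) ([\<not> a, a, a] @ v) ! i"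
    proof cases
      \<comment> \<open>Beyond the block nothing changes, since the three letters lead to the same
        state in either order.\<close>
      case 5
      then show ?thesis using i
        by (cases a) (auto simp: map_block_def reverse_block_def numeral_3_eq_3)
    qed (simp_all add: map_block_def reverse_block_def s s[unfolded One_nat_def] t \<tau> \<tau>'
        del: nth_word_seq coloring_of_seq_simps(3) append.simps One_nat_def)
  next
    show "map_block 0 3 \<tau> (reverse_block 0 3 ?lam) Ceiling = e" by simp
  next
    show "map_block 0 3 \<tau> (reverse_block 0 3 ?lam) Floor = e" by simp
  qed (rule ext)
  moreover have "sector_move (length v + 3) ?lam (map_block 0 3 \<tau> (reverse_block 0 3 ?lam))"
    by (rule sector_move.O32; (unfold s coloring_of_seq_simps)?)
      (use assms(2) i \<tau> in simp_all)
  ultimately show ?thesis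
    by (simp only:)
qed

text \<open>Three equal steps run once around the triangle, giving \<open>x, z, x + z, x\<close> on
  four faces; the reversed block runs around it the other way.\<close>

lemma sector_move_flip:
  assumes "v \<noteq> []"
  shows "sector_move (length v + 3) (word_coloring e (x, y) ([a, a, a] @ v))
    (word_coloring e (x, y) ([\<not> a, \<not> a, \<not> a] @ v))"
proof -
  let ?lam = "word_coloring e (x, y) ([a, a, a] @ v)"
  define z where "z = fst (step a (x, y))"
  have s: "?lam (Side 0) = x" "?lam (Side 1) = z" "?lam (Side 2) = x + z" "?lam (Side 3) = x"
    using assms by (cases a, auto simp: word_seq_Cons z_def nth_Cons' elim!: word_seq_not_Nil[of v])+
  have t: "word_seq (x, y) ([\<not> a, \<not> a, \<not> a] @ v) ! 0 = x" "word_seq (x, y) ([\<not> a, \<not> a, \<not> a] @ v) ! 1 = x + z" "word_seq (x, y) ([\<not> a, \<not> a, \<not> a] @ v) ! 2 = z" "word_seq (x, y) ([\<not> a, \<not> a, \<not> a] @ v) ! 3 = x"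
    using assms by (cases a, auto simp: word_seq_Cons z_def nth_Cons' elim!: word_seq_not_Nil[of v])+
  have ext: "reverse_block 0 3 ?lam
      \<in> extensional (facets (length (word_seq (x, y) ([\<not> a, \<not> a, \<not> a] @ v))))"
    using assms coloring_of_seq_simps(4)[of e "word_seq (x, y) ([a, a, a] @ v)"]
    by (intro extensional_block_maps) auto
  have "word_coloring e (x, y) ([\<not> a, \<not> a, \<not> a] @ v) = reverse_block 0 3 ?lam"
  proof (rule sym[OF eq_coloring_of_seq])
    fix i assume i: "i < length (word_seq (x, y) ([\<not> a, \<not> a, \<not> a] @ v))"
    consider "i = 0" | "i = 1" | "i = 2" | "i = 3" | j where "i = Suc (Suc (Suc (Suc j)))"
      by (metis One_nat_def numeral_2_eq_2 numeral_3_eq_3 old.nat.exhaust)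
    then show "reverse_block 0 3 ?lam (Side i)
        = word_seq (x, y) ([\<not> a, \<not> a, \<not> a] @ v) ! i"
    proof cases
      case 5
      then show ?thesis using i
        by (cases a) (auto simp: reverse_block_def numeral_3_eq_3)
    qed (simp_all add: reverse_block_def s s[unfolded One_nat_def] t
        del: nth_word_seq coloring_of_seq_simps(3) append.simps One_nat_def)
  next
    show "reverse_block 0 3 ?lam Ceiling = e" by simp
  next
    show "reverse_block 0 3 ?lam Floor = e" by simp
  qed (rule ext)
  moreover have "sector_move (length v + 3) ?lam (reverse_block 0 3 ?lam)"
    by (rule sector_move.O1; (unfold s)?) (use assms in simp_all)
  ultimately show ?thesis
    by (simp only:)
qed

text \<open>A rotation changes the initial state, which a linear map restores. Shifts and flips are
  single operations on four faces, apart from the degenerate cases treated separately.\<close>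

lemma sector_equivalent_word_move:
  assumes "word_move w w'" "indep_triple e x y" "closed_word w" "length w \<ge> 3"
  shows "sector_equivalent (length w) (word_coloring e (x, y) w) (word_coloring e (x, y) w')"
proof -
  have closed': "closed_word w'" and len': "length w' = length w"
    using assms(1,3) word_move_closed word_move_length by auto
  note xy = assms(2)
  have triv: "trivial_coloring (length w) (word_coloring e (x, y) w)"
    "trivial_coloring (length w) (word_coloring e (x, y) w')"
    using trivial_word_coloring[OF assms(3)] trivial_word_coloring[OF closed'] assms(4) len' xy
    by auto
  show ?thesis
    using assms(1)
  proof cases
    case (rotate a v)
    let ?s = "step a (x, y)"
    have s: "indep_triple e (fst ?s) (snd ?s)"
      using indep_step(1)[of e "(x, y)" a] xy by simp
    have "sector_move (length w) (word_coloring e (x, y) w) (word_coloring e ?s w')"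
      using sector_move.rotation[of "length w" "word_coloring e (x, y) w" 1]
        permute_sides_word_coloring[of a v e "(x, y)"] assms(3) rotate by simp
    moreover have "trivial_coloring (length w) (word_coloring e ?s w')"
      using trivial_word_coloring[OF closed' _ s] assms(4) len' by simp
    ultimately have "sector_equivalent (length w) (word_coloring e (x, y) w) (word_coloring e ?s w')"
      using triv sector_equivalent_move by blast
    also have "sector_equivalent (length w) (word_coloring e ?s w') (word_coloring e (x, y) w')"
      using sector_equivalent_change_state[OF assms(2) s closed'] assms(4) len'
      by (simp add: sector_equivalent_sym)
    finally show ?thesis .
  next
    case (shift a b v)
    show ?thesis
    proof (cases "a = b")
      case True
      then show ?thesis using shift triv(1) by (simp add: sector_equivalent_refl)
    next
      case False
      then have b: "b = (\<not> a)" by auto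
      \<comment> \<open>The three letters \<open>a, a, \<not> a\<close> alone have weight 4 or 5 and
        are not a closed word.\<close>
      have "v \<noteq> []"
        using assms(3) unfolding shift b by (cases a) (auto simp: closed_word_def, presburger+)
      then show ?thesis
        using sector_move_shift[OF xy, of v a] triv shift b
        by (intro sector_equivalent_move) (auto simp: add.commute numeral_3_eq_3)
    qed
  next
    case (flip a v)
    show ?thesis
    proof (cases "v = []")
      case True
      \<comment> \<open>With three faces there is no block of four. The state
        \<open>(x, x + y)\<close> orients the triangle the other way, so from it \<open>w'\<close>
        gives the coloring that \<open>w\<close> gives from \<open>(x, y)\<close>, and a linear
        change of state suffices.\<close>
      have "indep_triple e x (x + y)"
        using indep_step(2)[of e "(x, y)" False] xy by simp
      moreover have "word_seq (x, x + y) w' = word_seq (x, y) w"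
        unfolding word_seq_def flip True by (cases a) (simp_all add: upt_rec)
      ultimately show ?thesis
        using sector_equivalent_change_state[OF assms(2) _ closed', of "(x, x + y)"] assms(4) len'
        by (simp add: sector_equivalent_sym)
    next
      case False
      then show ?thesis
        using sector_move_flip[of v e x y a] triv flip
        by (intro sector_equivalent_move) (auto simp: add.commute numeral_3_eq_3)
    qed
  qed
qed

lemma sector_equivalent_word_equiv:
  assumes "w \<simeq> w'" "indep_triple e x y" "closed_word w" "length w \<ge> 3"
  shows "sector_equivalent (length w) (word_coloring e (x, y) w) (word_coloring e (x, y) w')"
proof -
  have "closed_word w' \<and> length w' = length w \<and>
      sector_equivalent (length w) (word_coloring e (x, y) w) (word_coloring e (x, y) w')"
    using assms(1)
  proof (induction rule: equivclp_induct)
    case base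
    then show ?case
      using trivial_word_coloring[of w e "(x, y)"] assms
      by (simp add: sector_equivalent_refl)
  next
    case (step u v)
    have "closed_word v" "length v = length w"
      using step word_move_closed word_move_length by metis+
    moreover have "sector_equivalent (length w) (word_coloring e (x, y) u) (word_coloring e (x, y) v)"
      using step sector_equivalent_word_move[OF _ assms(2)] assms(4) calculation
      by (metis sector_equivalent_sym)
    ultimately show ?case
      using step by (blast intro: sector_equivalent_trans)
  qed
  then show ?thesis by blast
qed

section \<open>Planar colorings\<close>

text \<open>From every state the two letters lead to the two colors other than the current one, so
  each change of color is a step.\<close>

lemma ex_word_of_walk:
  assumes "indep_triple e x y" "f 0 = x"
    and "\<And>i. i \<le> n \<Longrightarrow> f i \<in> {x, y, x + y}" "\<And>i. i < n \<Longrightarrow> f i \<noteq> f (Suc i)"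
  shows "\<exists>w. length w = n \<and> (\<forall>i\<le>n. fst (fold step (take i w) (x, y)) = f i)"
  using assms(3,4)
proof (induction n)
  case 0
  then show ?case using assms(2) by simp
next
  case (Suc n)
  then obtain w where w: "length w = n" "\<forall>i\<le>n. fst (fold step (take i w) (x, y)) = f i"
    by (metis le_SucI less_SucI)
  have "fst (fold step w (x, y)) = f n"
    using w by (metis order_refl take_all)
  have "fst (step True (fold step w (x, y))) = f (Suc n) \<or>
      fst (step False (fold step w (x, y))) = f (Suc n)"
  proof -
    have f: "f (Suc n) \<in> {x, y, x + y} - {f n}"
      using Suc.prems(1)[of "Suc n"] Suc.prems(2)[of n] by auto
    consider "fold step w (x, y) = (x, y)" | "fold step w (x, y) = (y, x + y)"
      | "fold step w (x, y) = (x + y, x)"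
      using fold_step_cases[of w x y] by blast
    then show ?thesis
      using f \<open>fst (fold step w (x, y)) = f n\<close>[symmetric] by cases auto
  qed
  then obtain a where "fst (step a (fold step w (x, y))) = f (Suc n)"
    by blast
  then have "\<forall>i\<le>Suc n. fst (fold step (take i (w @ [a])) (x, y)) = f i"
    using w by (simp add: le_Suc_eq)
  then show ?case
    using w(1) by (intro exI[of _ "w @ [a]"]) simp
qed

text \<open>Naming the basis after the first two side faces makes \<open>x + y\<close> the only
  color whose occurrence is open.\<close>

definition planar_coloring :: "nat \<Rightarrow> vec3 \<Rightarrow> vec3 \<Rightarrow> vec3 \<Rightarrow> coloring \<Rightarrow> bool" where
  "planar_coloring m e x y lam \<longleftrightarrow> trivial_coloring m lam \<and> lam Ceiling = e \<and>
     lam (Side 0) = x \<and> lam (Side 1) = y \<and> (\<forall>i<m. lam (Side i) \<in> {x, y, x + y})"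

lemma planar_coloringD:
  assumes "planar_coloring m e x y lam" "m \<ge> 2"
  shows "lam \<in> extensional (facets m)" "lam Floor = e" "indep_triple e x y"
    and "\<And>i. i < m \<Longrightarrow> lam (Side i) \<noteq> lam (Side (Suc i mod m))"
proof -
  have *: "lam \<in> extensional (facets m)" "lam Floor = e"
    "\<And>i. i < m \<Longrightarrow> indep_triple e (lam (Side i)) (lam (Side (Suc i mod m)))"
    using assms by (auto simp: planar_coloring_def trivial_coloring_iff)
  show "lam \<in> extensional (facets m)" "lam Floor = e"
    using * by auto
  show "indep_triple e x y"
    using *(3)[of 0] assms by (simp add: planar_coloring_def)
  show "\<And>i. i < m \<Longrightarrow> lam (Side i) \<noteq> lam (Side (Suc i mod m))"
    using *(3) by (force simp: indep_triple_def)
qed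

lemma planar_coloring_word:
  assumes "planar_coloring m e x y lam" "m \<ge> 2"
  obtains w where "length w = m" "closed_word w" "lam = word_coloring e (x, y) w"
proof -
  note lam = planar_coloringD[OF assms]
  \<comment> \<open>Reading the sides cyclically adds the step from the last face back to face
    0.\<close>
  define f where "f i = lam (Side (i mod m))" for i
  have f0: "f 0 = x"
    using assms by (simp add: f_def planar_coloring_def)
  have "f i \<in> {x, y, x + y}" for i
    using assms by (simp add: f_def planar_coloring_def)
  moreover have "f i \<noteq> f (Suc i)" for i
    using lam(4)[of "i mod m"] assms(2) by (simp add: f_def mod_Suc_eq)
  ultimately obtain w where w: "length w = m" "\<And>i. i \<le> m \<Longrightarrow> fst (fold step (take i w) (x, y)) = f i"
    using ex_word_of_walk[of e x y f m] lam(3) f0 by metis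
  have "fst (fold step w (x, y)) = x"
    using w(2)[of m] w(1) f0 by (simp add: f_def)
  \<comment> \<open>The three reachable states have different first components, so the color alone
    determines the state.\<close>
  then have "fold step w (x, y) = (x, y)"
    using fold_step_cases[of w x y] lam(3) by (auto simp: indep_triple_iff)
  then have "closed_word w"
    using lam(3) by (intro closed_wordI) (auto simp: indep_triple_iff)
  moreover have "lam = word_coloring e (x, y) w"
    using lam(1,2) assms(1) w by (intro eq_coloring_of_seq) (auto simp: f_def planar_coloring_def)
  ultimately show ?thesis
    using w(1) that by blast
qed

text \<open>Without two equal neighbors the letters alternate, consecutive steps cancel, and the
  walk visits only its first two colors.\<close>

lemma pair_in_word:
  assumes "i < length w" "fst (fold step (take i w) s) \<notin> {fst s, fst (step (w ! 0) s)}"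
  obtains u a v where "w = u @ [a, a] @ v"
proof -
  have "\<exists>j. Suc j < length w \<and> w ! j = w ! Suc j"
  proof (rule ccontr)
    assume alt: "\<nexists>j. Suc j < length w \<and> w ! j = w ! Suc j"
    have "fst (fold step (take i w) s) \<in> {fst s, fst (step (w ! 0) s)}"
      using assms(1)
    proof (induction i rule: less_induct)
      case (less i)
      consider "i = 0" | "i = 1" | j where "i = Suc (Suc j)"
        by (metis One_nat_def old.nat.exhaust)
      then show ?case
      proof cases
        case 2
        then show ?thesis using less.prems by (cases w) auto
      next
        case 3
        then have "w ! Suc j = (\<not> w ! j)"
          using alt less.prems by auto
        then have "fold step (take i w) s = fold step (take j w) s"
          using less.prems 3 by (simp add: take_Suc_conv_app_nth)
        then show ?thesis using less 3 by simp
      qed simp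
    qed
    then show False using assms(2) by blast
  qed
  then obtain j where j: "Suc j < length w" "w ! j = w ! Suc j" by blast
  have "drop j w = [w ! j, w ! Suc j] @ drop (Suc (Suc j)) w"
    using j(1) by (simp add: Cons_nth_drop_Suc)
  then have "w = take j w @ [w ! j, w ! j] @ drop (Suc (Suc j)) w"
    using append_take_drop_id[of j w] j(2) by simp
  then show ?thesis by (rule that)
qed

text \<open>The third color forces a pair in each word. Both words are moved to the common state
  \<open>(\<alpha>, \<beta>)\<close>, where they are closed, equally long and hence
  equivalent.\<close>

lemma planar_colorings_equivalent:
  assumes "planar_coloring m e x y lam" "planar_coloring m e x' y' mu" "m \<ge> 3"
    and "i < m" "lam (Side i) = x + y" "j < m" "mu (Side j) = x' + y'"
    and "indep_triple e \<alpha> \<beta>"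
  shows "sector_equivalent m lam mu"
proof -
  have norm: "\<exists>w u a v. length w = m \<and> closed_word w \<and> w = u @ [a, a] @ v \<and>
      sector_equivalent m (word_coloring e (\<alpha>, \<beta>) w) lam"
    if lam: "planar_coloring m e x y lam" and i: "i < m" "lam (Side i) = x + y" for lam x y i
  proof -
    have m: "m \<ge> 2" using assms(3) by simp
    obtain w where w: "length w = m" "closed_word w" "lam = word_coloring e (x, y) w"
      using planar_coloring_word[OF lam m] .
    have xy: "indep_triple e x y"
      using planar_coloringD(3)[OF lam m] .
    have "fst (step (w ! 0) (x, y)) = lam (Side 1)"
      using w m by (simp add: take_Suc_conv_app_nth)
    also have "\<dots> = y"
      using lam by (simp add: planar_coloring_def)
    finally have "fst (fold step (take i w) (x, y)) \<notin> {fst (x, y), fst (step (w ! 0) (x, y))}"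
      using i w xy by (auto simp: indep_triple_iff)
    then obtain u a v where "w = u @ [a, a] @ v"
      using pair_in_word i w(1) by metis
    moreover have "sector_equivalent m (word_coloring e (\<alpha>, \<beta>) w) lam"
      using sector_equivalent_change_state[OF assms(8) _ w(2), of "(x, y)"] xy m w by simp
    ultimately show ?thesis
      using w by blast
  qed
  obtain w u a v where w: "length w = m" "closed_word w" "w = u @ [a, a] @ v"
    "sector_equivalent m (word_coloring e (\<alpha>, \<beta>) w) lam"
    using norm[OF assms(1,4,5)] by blast
  obtain w' u' a' v' where w': "length w' = m" "closed_word w'" "w' = u' @ [a', a'] @ v'"
    "sector_equivalent m (word_coloring e (\<alpha>, \<beta>) w') mu"
    using norm[OF assms(2,6,7)] by blast
  have "w \<simeq> w'"
    using closed_words_equiv[OF w(2) w'(2) _ w(3) w'(3)] w(1) w'(1) by simp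
  then have "sector_equivalent m (word_coloring e (\<alpha>, \<beta>) w) (word_coloring e (\<alpha>, \<beta>) w')"
    using sector_equivalent_word_equiv[OF _ assms(8) w(2)] w(1) assms(3) by simp
  then show ?thesis
    using w(4) w'(4) by (meson sector_equivalent_sym sector_equivalent_trans)
qed

text \<open>The colors of the first two sides are independent, so by dimension they span the plane
  of all side colors, whose nonzero vectors are \<open>x, y, x + y\<close>.\<close>

lemma two_independent_planar:
  assumes "m \<ge> 2" "trivial_coloring m lam" "two_independent m lam"
  shows "planar_coloring m (lam Ceiling) (lam (Side 0)) (lam (Side 1)) lam"
proof -
  define x y where "x = lam (Side 0)" and "y = lam (Side 1)"
  have indep: "indep_triple (lam Ceiling) (lam (Side i)) (lam (Side (Suc i mod m)))" if "i < m" for i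
    using assms(2) that unfolding trivial_coloring_iff[OF assms(1)] by blast
  have xy: "indep_triple (lam Ceiling) x y"
    using indep[of 0] assms(1) by (simp add: x_def y_def)
  have "vec.independent {x, y}" "x \<noteq> y"
    using xy vec.independent_mono[of "{lam Ceiling, x, y}" "{x, y}"]
    by (auto simp: indep_triple_def)
  then have "vec.dim {x, y} = 2"
    by (simp add: vec.dim_eq_card_independent)
  moreover have "{x, y} \<subseteq> lam ` Side ` {..<m}"
    using assms(1) by (auto simp: x_def y_def)
  ultimately have span: "vec.span {x, y} = vec.span (lam ` Side ` {..<m})"
    using assms(3) by (intro vec.dim_eq_span) (auto simp: two_independent_def)
  have "lam (Side i) \<in> {x, y, x + y}" if "i < m" for i
  proof -
    have "lam (Side i) \<in> vec.span {x, y}"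
      unfolding span using that by (intro vec.span_base) auto
    moreover have "lam (Side i) \<noteq> 0"
      using indep[OF that] by (simp add: indep_triple_iff)
    ultimately show ?thesis
      by (simp add: vec3_span_pair)
  qed
  then show ?thesis
    using assms(2) by (simp add: planar_coloring_def x_def y_def)
qed

text \<open>Disregarding bars means working modulo \<open>e\<close>, where the nonzero vectors of
  any plane avoiding \<open>e\<close> become the three nonzero classes.\<close>

lemma property_star_iff:
  assumes "indep_triple e \<alpha> \<beta>" "planar_coloring m e x y lam" "m \<ge> 2"
  shows "property_star m e \<alpha> \<beta> lam \<longleftrightarrow> (\<exists>i<m. lam (Side i) = x + y)"
proof
  assume star: "property_star m e \<alpha> \<beta> lam"
  show "\<exists>i<m. lam (Side i) = x + y"
  proof (rule ccontr)
    assume "\<not> (\<exists>i<m. lam (Side i) = x + y)"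
    then have sides: "lam (Side i) \<in> {x, y}" if "i < m" for i
      using assms(2) that by (auto simp: planar_coloring_def)
    have letter: "z \<in> {x, x + e} \<or> z \<in> {y, y + e}" if "z \<in> {\<alpha>, \<beta>, \<alpha> + \<beta>}" for z
    proof -
      obtain i where "i < m" "lam (Side i) \<in> {z, z + e}"
        using star \<open>z \<in> _\<close> unfolding property_star_def by blast
      with sides[of i] show ?thesis by auto
    qed
    \<comment> \<open>If only \<open>x\<close> and \<open>y\<close> occur, two of the three letters
      fall into one class modulo \<open>e\<close>, and their sum would be \<open>0\<close> or
      \<open>e\<close>.\<close>
    have same: "u + v \<in> {0, e}" if "u \<in> {t, t + e}" "v \<in> {t, t + e}" for t u v
      using that by (auto simp: add.commute)
    have "\<alpha> + \<beta> \<notin> {0, e}" "\<alpha> + (\<alpha> + \<beta>) \<notin> {0, e}" "\<beta> + (\<alpha> + \<beta>) \<notin> {0, e}"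
      using assms(1) by (auto simp: indep_triple_iff vec3_add_eq_0_iff)
    then show False
      using letter[of \<alpha>] letter[of \<beta>] letter[of "\<alpha> + \<beta>"] same by blast
  qed
next
  assume "\<exists>i<m. lam (Side i) = x + y"
  moreover have "lam (Side 0) = x" "lam (Side 1) = y" "0 < m" "1 < m"
    using assms(2,3) by (auto simp: planar_coloring_def)
  ultimately have attained: "\<exists>i<m. lam (Side i) = z" if "z \<in> {x, y, x + y}" for z
    using that by blast
  have "z \<in> {x, y, x + y} \<or> z + e \<in> {x, y, x + y}" if "z \<in> {\<alpha>, \<beta>, \<alpha> + \<beta>}" for z
  proof -
    have "z \<noteq> 0" "z + e \<noteq> 0"
      using that assms(1) by (auto simp: indep_triple_iff vec3_add_eq_0_iff)
    then show ?thesis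
      using indep_triple_cases[OF planar_coloringD(3)[OF assms(2,3)], of z] by blast
  qed
  then have "\<exists>i<m. lam (Side i) \<in> {z, z + e}" if "z \<in> {\<alpha>, \<beta>, \<alpha> + \<beta>}" for z
    using that attained by (metis insert_iff)
  then show "property_star m e \<alpha> \<beta> lam"
    unfolding property_star_def by blast
qed

section \<open>Canonical sequences and the two-colored case\<close>

lemma nth_repeat_pair:
  "i < 2 * n \<Longrightarrow> repeat_pair n a b ! i = (if even i then a else b)"
proof (induction n arbitrary: i)
  case (Suc n)
  consider "i = 0" | "i = 1" | j where "i = Suc (Suc j)"
    by (metis One_nat_def old.nat.exhaust)
  then show ?case
    using Suc by cases (auto simp: repeat_pair_def)
qed simp

lemma length_repeat_pair [simp]: "length (repeat_pair n a b) = 2 * n"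
  by (induction n) (auto simp: repeat_pair_def)

lemma length_seqs:
  "even m \<Longrightarrow> length (seq_C1 m \<alpha> \<beta>) = m"
  "even m \<Longrightarrow> m \<ge> 2 \<Longrightarrow> length (seq_C2 m \<alpha> \<beta>) = m"
  "odd m \<Longrightarrow> m \<ge> 3 \<Longrightarrow> length (seq_C3 m \<alpha> \<beta>) = m"
  by (auto simp: seq_C1_def seq_C2_def seq_C3_def)

lemma nth_seq_C1:
  "even m \<Longrightarrow> i < m \<Longrightarrow> seq_C1 m \<alpha> \<beta> ! i = (if even i then \<alpha> else \<beta>)"
  unfolding seq_C1_def by (rule nth_repeat_pair) auto

lemma nth_seq_C2:
  assumes "even m" "i < m"
  shows "seq_C2 m \<alpha> \<beta> ! i = (if even i then \<alpha> else if i = 1 then \<alpha> + \<beta> else \<beta>)"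
proof -
  consider "i = 0" | "i = 1" | j where "i = Suc (Suc j)"
    by (metis One_nat_def old.nat.exhaust)
  then show ?thesis
    using assms by cases (auto simp: seq_C2_def nth_repeat_pair)
qed

lemma nth_seq_C3:
  assumes "odd m" "i < m"
  shows "seq_C3 m \<alpha> \<beta> ! i
    = (if i = 0 then \<alpha> else if i = 1 then \<alpha> + \<beta> else if even i then \<beta> else \<alpha>)"
proof -
  consider "i = 0" | "i = 1" | "i = 2" | j where "i = Suc (Suc (Suc j))"
    by (metis One_nat_def numeral_2_eq_2 old.nat.exhaust)
  then show ?thesis
    using assms by cases (auto simp: seq_C3_def nth_repeat_pair)
qed

lemma planar_seq_C2:
  assumes "even m" "m \<ge> 3" "indep_triple e \<alpha> \<beta>"
  shows "planar_coloring m e \<alpha> (\<alpha> + \<beta>) (coloring_of_seq e (seq_C2 m \<alpha> \<beta>))"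
proof -
  have len: "length (seq_C2 m \<alpha> \<beta>) = m"
    using assms by (intro length_seqs) auto
  have "indep_triple e (seq_C2 m \<alpha> \<beta> ! i) (seq_C2 m \<alpha> \<beta> ! (Suc i mod m))" if "i < m" for i
    using assms that indep_triple_rearrange[OF assms(3)]
    by (auto simp: mod_Suc nth_seq_C2)
  then show ?thesis
    using trivial_coloring_of_seq[of "seq_C2 m \<alpha> \<beta>" e] assms len
    by (auto simp: planar_coloring_def nth_seq_C2)
qed

lemma planar_seq_C3:
  assumes "odd m" "m \<ge> 3" "indep_triple e \<alpha> \<beta>"
  shows "planar_coloring m e \<alpha> (\<alpha> + \<beta>) (coloring_of_seq e (seq_C3 m \<alpha> \<beta>))"
proof -
  have len: "length (seq_C3 m \<alpha> \<beta>) = m"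
    using assms by (intro length_seqs) auto
  have "indep_triple e (seq_C3 m \<alpha> \<beta> ! i) (seq_C3 m \<alpha> \<beta> ! (Suc i mod m))" if "i < m" for i
    using assms that indep_triple_rearrange[OF assms(3)]
    by (auto simp: mod_Suc nth_seq_C3)
  then show ?thesis
    using trivial_coloring_of_seq[of "seq_C3 m \<alpha> \<beta>" e] assms len
    by (auto simp: planar_coloring_def nth_seq_C3)
qed

lemma planar_two_colors:
  assumes "planar_coloring m e x y lam" "m \<ge> 3" "\<And>i. i < m \<Longrightarrow> lam (Side i) \<noteq> x + y"
  shows "even m" "lam = coloring_of_seq e (seq_C1 m x y)"
proof -
  have m: "m \<ge> 2" using assms(2) by simp
  note lam = planar_coloringD[OF assms(1) m]
  have sides: "lam (Side i) \<in> {x, y}" if "i < m" for i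
    using assms(1,3) that by (auto simp: planar_coloring_def)
  have alt: "lam (Side i) = (if even i then x else y)" if "i < m" for i
    using that
  proof (induction i)
    case 0
    then show ?case using assms(1) by (simp add: planar_coloring_def)
  next
    case (Suc i)
    then show ?case using lam(4)[of i] sides[of "Suc i"] by (auto split: if_splits)
  qed
  show "even m"
    \<comment> \<open>The last face is adjacent to face 0, which has color \<open>x\<close>, so its
      index \<open>m - 1\<close> is odd.\<close>
    using lam(4)[of "m - 1"] alt[of "m - 1"] alt[of 0] assms(2) by (auto split: if_splits)
  then show "lam = coloring_of_seq e (seq_C1 m x y)"
    using lam(1,2) assms(1) alt
    by (intro eq_coloring_of_seq) (auto simp: length_seqs nth_seq_C1 planar_coloring_def)
qed

lemma seq_C1_equivalent:
  assumes "even m" "m \<ge> 2" "indep_triple e x y" "indep_triple e \<alpha> \<beta>"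
  shows "sector_equivalent m (coloring_of_seq e (seq_C1 m x y)) (coloring_of_seq e (seq_C1 m \<alpha> \<beta>))"
proof -
  obtain \<sigma> where \<sigma>: "linear_map \<sigma>" "bij \<sigma>" "\<sigma> e = e" "\<sigma> x = \<alpha>" "\<sigma> y = \<beta>"
    using ex_bij_linear_map[OF assms(3,4)] .
  have triv: "trivial_coloring m (coloring_of_seq e (seq_C1 m x y))" if "indep_triple e x y" for x y
  proof -
    have "indep_triple e (seq_C1 m x y ! i) (seq_C1 m x y ! (Suc i mod m))" if "i < m" for i
      using assms(1,2) that \<open>indep_triple e x y\<close> indep_triple_rearrange(1)[OF \<open>indep_triple e x y\<close>]
      by (auto simp: mod_Suc nth_seq_C1)
    then show ?thesis
      using trivial_coloring_of_seq[of "seq_C1 m x y" e] assms(1,2) by (simp add: length_seqs)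
  qed
  have "map \<sigma> (seq_C1 m x y) = seq_C1 m \<alpha> \<beta>"
    using \<sigma>(4,5) assms(1) by (intro nth_equalityI) (auto simp: length_seqs nth_seq_C1)
  then show ?thesis
    using sector_equivalent_linear_map[OF \<sigma>(1-3), of "seq_C1 m x y"] triv assms
    by (simp add: length_seqs)
qed

theorem proposition5p2:
  fixes m :: nat and e1 \<alpha> \<beta> :: vec3 and lam :: coloring
  assumes "m \<ge> 3"
    and "is_basis e1 \<alpha> \<beta>"
    and "trivial_coloring m lam"
    and "lam Ceiling = e1" and "lam Floor = e1"
    and "two_independent m lam"
  shows "(\<not> property_star m e1 \<alpha> \<beta> lam \<longrightarrow>
            even m \<and> sector_equivalent m lam (coloring_of_seq e1 (seq_C1 m \<alpha> \<beta>)))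
       \<and> (property_star m e1 \<alpha> \<beta> lam \<longrightarrow>
            (even m \<and> sector_equivalent m lam (coloring_of_seq e1 (seq_C2 m \<alpha> \<beta>)))
          \<or> (odd m \<and> sector_equivalent m lam (coloring_of_seq e1 (seq_C3 m \<alpha> \<beta>))))"
proof -
  define x y where "x = lam (Side 0)" and "y = lam (Side 1)"
  have m: "m \<ge> 2" using assms(1) by simp
  have ab: "indep_triple e1 \<alpha> \<beta>"
    using assms(2) by (simp add: is_basis_iff)
  have lam: "planar_coloring m e1 x y lam"
    using two_independent_planar[OF m assms(3,6)] assms(4) by (simp add: x_def y_def)
  have xy: "indep_triple e1 x y"
    using planar_coloringD(3)[OF lam m] .
  note star = property_star_iff[OF ab lam m]
  show ?thesis
  proof (cases "property_star m e1 \<alpha> \<beta> lam")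
    case False
    then show ?thesis
      using planar_two_colors[OF lam assms(1)] seq_C1_equivalent[OF _ m xy ab] star by metis
  next
    case True
    then obtain i where i: "i < m" "lam (Side i) = x + y"
      using star by blast
    show ?thesis
    proof (cases "even m")
      case even: True
      \<comment> \<open>Face 3 of \<open>seq_C2\<close> has color \<open>\<beta>\<close>, the third
        color \<alpha> + (\<alpha> + \<beta>); in \<open>seq_C3\<close> face 2 serves the same
        purpose.\<close>
      have "3 < m" using assms(1) even by (cases "m = 3") auto
      then have "sector_equivalent m lam (coloring_of_seq e1 (seq_C2 m \<alpha> \<beta>))"
        using planar_colorings_equivalent[OF lam planar_seq_C2[OF even assms(1) ab] assms(1) i, of 3]
          ab even by (simp add: length_seqs nth_seq_C2)
      then show ?thesis using True even by blast
    next
      case odd: False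
      have "sector_equivalent m lam (coloring_of_seq e1 (seq_C3 m \<alpha> \<beta>))"
        using planar_colorings_equivalent[OF lam planar_seq_C3[OF odd assms(1) ab] assms(1) i, of 2]
          assms(1) ab odd by (simp add: length_seqs nth_seq_C3)
      then show ?thesis using True odd by blast
    qed
  qed
qed

end
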